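(* $\mathfrak{g}_{\mathfrak{f}} \leq \mathfrak{b}^+$, where $\mathfrak{b}^+$ denotes the cardinal successor of the unbounded number $\mathfrak{b}$.
   Context: For $f,g \in {}^\omega\omega$, write $f \leq_{J^{\rm bd}_\omega} g$ iff there is $N<\omega$ with $f(n)\leq g(n)$ for all $n>N$. The unbounded number is $\mathfrak{b}=\min\{|\mathcal{F}| : \mathcal{F}\subseteq {}^\omega\omega \text{ has no } \leq_{J^{\rm bd}_\omega}\text{-upper bound in } {}^\omega\omega\}$. For infinite $A,B\subseteq\omega$, $B\subseteq^* A$ means $B\setminus A$ is finite; $[\omega]^{\aleph_0}$ is the set of infinite subsets of $\omega$ and $[\omega]^{<\aleph_0}$ the set of finite subsets. A family $\mathcal{A}\subseteq[\omega]^{\aleph_0}$ is groupwise dense if (i) whenever $B\subseteq A\in\mathcal{A}$ and $B\in[\omega]^{\aleph_0}$ then $B\in\mathcal{A}$, and (ii) for every strictly increasing sequence $\langle m_i : i<\omega\rangle\in{}^\omega\omega$ there is an infinite $\mathcal{U}\subseteq\omega$ with $\bigcup\{[m_i,m_{i+1}) : i\in\mathcal{U}\}\in\mathcal{A}$. A groupwise dense ideal is a groupwise dense $\mathcal{I}\subseteq[\omega]^{\aleph_0}$ such that $\mathcal{I}\cup[\omega]^{<\aleph_0}$ is an ideal of subsets of $\omega$. The cardinal $\mathfrak{g}_{\mathfrak{f}}$ is the minimal cardinal $\theta$ for which there is a sequence $\langle\mathcal{I}_\alpha:\alpha<\theta\rangle$ of groupwise dense ideals such that for every $B\in[\omega]^{\aleph_0}$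 there is $\alpha<\theta$ with $B\not\subseteq^* A$ for all $A\in\mathcal{I}_\alpha$. *)

theory Defs
  imports Main
begin

unbundle cardinal_syntax

text \<open>
  A cardinal is represented, as usual in HOL, by a relation \<open>r\<close> with \<open>Card_order r\<close>;
  cardinals over different types are compared with \<open>\<le>o\<close> and \<open>=o\<close>.  The minimum of a class
  of cardinals is therefore determined only up to \<open>=o\<close>, and \<open>min_card\<close> chooses a representative.
\<close>

definition min_card :: "'a rel set \<Rightarrow> 'a rel" where
  "min_card R = (SOME r. r \<in> R \<and> (\<forall>s\<in>R. r \<le>o s))"

lemma min_card_is_min:
  assumes "R \<noteq> {}" "\<And>r. r \<in> R \<Longrightarrow> Card_order r"
  shows "min_card R \<in> R \<and> (\<forall>s\<in>R. min_card R \<le>o s)"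
proof -
  have "\<exists>r. r \<in> R \<and> (\<forall>s\<in>R. r \<le>o s)"
    using exists_minim_Card_order[of R] assms by blast
  then show ?thesis unfolding min_card_def by (rule someI_ex)
qed


section \<open>The unbounded number\<close>

definition le_bd :: "(nat \<Rightarrow> nat) \<Rightarrow> (nat \<Rightarrow> nat) \<Rightarrow> bool" where
  "le_bd f g \<longleftrightarrow> (\<exists>N. \<forall>n>N. f n \<le> g n)"

definition has_upper_bound :: "(nat \<Rightarrow> nat) set \<Rightarrow> bool" where
  "has_upper_bound F \<longleftrightarrow> (\<exists>g. \<forall>f\<in>F. le_bd f g)"

definition unbounded_number :: "(nat \<Rightarrow> nat) rel" where
  "unbounded_number = min_card {|F| | F. \<not> has_upper_bound F}"

lemma not_has_upper_bound_UNIV: "\<not> has_upper_bound UNIV"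
proof
  assume "has_upper_bound UNIV"
  then obtain g where "\<forall>f. le_bd f g" unfolding has_upper_bound_def by auto
  then have "le_bd (\<lambda>n. Suc (g n)) g" by blast
  then show False unfolding le_bd_def by (meson lessI not_less_eq_eq order_refl)
qed

lemma unbounded_number_is_min:
  "\<exists>F. \<not> has_upper_bound F \<and> unbounded_number = |F|"
  "\<not> has_upper_bound F \<Longrightarrow> unbounded_number \<le>o |F|"
proof -
  let ?R = "{|F| | F. \<not> has_upper_bound F}"
  have "min_card ?R \<in> ?R \<and> (\<forall>s\<in>?R. min_card ?R \<le>o s)"
    using not_has_upper_bound_UNIV by (intro min_card_is_min) (auto simp: card_of_Card_order)
  then show "\<exists>F. \<not> has_upper_bound F \<and> unbounded_number = |F|"
    "\<not> has_upper_bound F \<Longrightarrow> unbounded_number \<le>o |F|"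
    unfolding unbounded_number_def by auto
qed


section \<open>Groupwise dense ideals\<close>

definition almost_subset :: "nat set \<Rightarrow> nat set \<Rightarrow> bool" (infix "\<subseteq>\<^sup>*" 50) where
  "B \<subseteq>\<^sup>* A \<longleftrightarrow> finite (B - A)"

definition groupwise_dense :: "nat set set \<Rightarrow> bool" where
  "groupwise_dense \<A> \<longleftrightarrow>
     (\<forall>A\<in>\<A>. infinite A) \<and>
     (\<forall>A B. B \<subseteq> A \<and> A \<in> \<A> \<and> infinite B \<longrightarrow> B \<in> \<A>) \<and>
     (\<forall>m :: nat \<Rightarrow> nat. strict_mono m \<longrightarrow>
        (\<exists>U. infinite U \<and> (\<Union>i\<in>U. {m i..<m (Suc i)}) \<in> \<A>))"

text \<open>
  Properness is not part of the definition; by \<open>gf_sequence_proper\<close> below, requiring it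
  would give the same cardinal \<open>gf\<close>.
\<close>

definition ideal_of_subsets :: "'a set set \<Rightarrow> bool" where
  "ideal_of_subsets J \<longleftrightarrow>
     {} \<in> J \<and> (\<forall>A B. B \<subseteq> A \<and> A \<in> J \<longrightarrow> B \<in> J) \<and> (\<forall>A\<in>J. \<forall>B\<in>J. A \<union> B \<in> J)"

definition groupwise_dense_ideal :: "nat set set \<Rightarrow> bool" where
  "groupwise_dense_ideal \<I> \<longleftrightarrow> groupwise_dense \<I> \<and> ideal_of_subsets (\<I> \<union> {A. finite A})"

text \<open>A sequence of length \<open>\<theta>\<close> is a function considered on the elements of the well-order \<open>\<theta>\<close>.\<close>

definition gf_sequence :: "'i rel \<Rightarrow> ('i \<Rightarrow> nat set set) \<Rightarrow> bool" where
  "gf_sequence \<theta> \<I> \<longleftrightarrow>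
     (\<forall>\<alpha>\<in>Field \<theta>. groupwise_dense_ideal (\<I> \<alpha>)) \<and>
     (\<forall>B. infinite B \<longrightarrow> (\<exists>\<alpha>\<in>Field \<theta>. \<forall>A\<in>\<I> \<alpha>. \<not> B \<subseteq>\<^sup>* A))"

text \<open>
  A minimum can only be formed over cardinals of one type.  The type \<^typ>\<open>nat set set\<close> of all
  families of subsets of \<open>\<omega>\<close> is large enough: \<open>gf_is_min\<close> shows that \<open>gf\<close> is attained
  and is minimal among the cardinals over arbitrary types.
\<close>

definition gf :: "nat set set rel" where
  "gf = min_card {\<theta>. Card_order \<theta> \<and> (\<exists>\<I>. gf_sequence \<theta> \<I>)}"

lemma ex_groupwise_dense_ideal_avoiding:
  assumes B: "infinite B"
  shows "\<exists>\<I>. groupwise_dense_ideal \<I> \<and> (\<forall>A\<in>\<I>. \<not> B \<subseteq>\<^sup>* A)"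
proof -
  define P where "P = {J. ideal_of_subsets J \<and> {A. finite A} \<subseteq> J \<and> B \<notin> J}"
  have "{A. finite A} \<in> P"
    using B by (auto simp: P_def ideal_of_subsets_def intro: finite_subset)
  then have "P \<noteq> {}" by blast
  moreover have "\<Union>C \<in> P" if C: "C \<noteq> {}" "subset.chain P C" for C
  proof -
    have CP: "C \<subseteq> P" and ch: "\<And>X Y. X \<in> C \<Longrightarrow> Y \<in> C \<Longrightarrow> X \<subseteq> Y \<or> Y \<subseteq> X"
      using C(2) by (auto simp: subset_chain_def)
    have "A \<union> A' \<in> \<Union>C" if AA': "A \<in> \<Union>C" "A' \<in> \<Union>C" for A A'
    proof -
      obtain X Y where XY: "X \<in> C" "Y \<in> C" "A \<in> X" "A' \<in> Y"
        using AA' by blast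
      obtain Z where Z: "Z \<in> C" "A \<in> Z" "A' \<in> Z"
        using ch[OF XY(1,2)] XY by blast
      then have "A \<union> A' \<in> Z" using CP unfolding P_def ideal_of_subsets_def by blast
      then show ?thesis using Z(1) by blast
    qed
    moreover have "{} \<in> \<Union>C" "{A. finite A} \<subseteq> \<Union>C" "B \<notin> \<Union>C"
      using C(1) CP by (auto simp: P_def ideal_of_subsets_def)
    moreover have "A' \<in> \<Union>C" if "A' \<subseteq> A" "A \<in> \<Union>C" for A A'
      using that CP unfolding P_def ideal_of_subsets_def by blast
    ultimately have "ideal_of_subsets (\<Union>C)"
      unfolding ideal_of_subsets_def by (intro conjI allI ballI impI) metis+
    with \<open>{A. finite A} \<subseteq> \<Union>C\<close> \<open>B \<notin> \<Union>C\<close> show ?thesis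
      unfolding P_def by (intro CollectI conjI)
  qed
  ultimately obtain J where JP: "J \<in> P" and max: "\<And>X. X \<in> P \<Longrightarrow> J \<subseteq> X \<Longrightarrow> X = J"
    using subset_Zorn_nonempty[of P] by blast
  have fin: "\<And>A. finite A \<Longrightarrow> A \<in> J" and BJ: "B \<notin> J"
    and dn: "\<And>A A'. A' \<subseteq> A \<Longrightarrow> A \<in> J \<Longrightarrow> A' \<in> J"
    and un: "\<And>A A'. A \<in> J \<Longrightarrow> A' \<in> J \<Longrightarrow> A \<union> A' \<in> J"
    using JP by (auto simp: P_def ideal_of_subsets_def)
  have cover: "\<exists>j\<in>J. B \<subseteq> X \<union> j" if X: "X \<notin> J" for X
  proof (rule ccontr)
    assume neg: "\<not> ?thesis"
    define K where "K = {Y. \<exists>j\<in>J. Y \<subseteq> X \<union> j}"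
    have "ideal_of_subsets K"
      unfolding ideal_of_subsets_def
    proof (intro conjI allI ballI impI)
      show "{} \<in> K" using fin[of "{}"] by (auto simp: K_def)
    next
      fix A A' assume "A' \<subseteq> A \<and> A \<in> K" then show "A' \<in> K" unfolding K_def by blast
    next
      fix A A' assume "A \<in> K" "A' \<in> K"
      then obtain j j' where j: "j \<in> J" "j' \<in> J" "A \<subseteq> X \<union> j" "A' \<subseteq> X \<union> j'"
        unfolding K_def by blast
      then have "A \<union> A' \<subseteq> X \<union> (j \<union> j')" by blast
      with un[OF j(1,2)] show "A \<union> A' \<in> K" unfolding K_def by blast
    qed
    moreover have "J \<subseteq> K" by (auto simp: K_def)
    ultimately have "K \<in> P" using neg fin by (auto simp: P_def K_def)
    then have "K = J" using \<open>J \<subseteq> K\<close> max by blast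
    moreover have "X \<in> K" using fin[of "{}"] by (auto simp: K_def)
    ultimately show False using X by blast
  qed
  have prime: "X \<in> J \<or> Y \<in> J" if "X \<inter> Y = {}" for X Y
  proof (rule ccontr)
    assume "\<not> ?thesis"
    then obtain j j' where j: "j \<in> J" "j' \<in> J" "B \<subseteq> X \<union> j" "B \<subseteq> Y \<union> j'"
      using cover by meson
    then have "B \<subseteq> j \<union> j'" using that by blast
    then show False using dn[OF _ un[OF j(1,2)]] BJ by simp
  qed
  define \<I> where "\<I> = {A \<in> J. infinite A}"
  have "groupwise_dense \<I>"
    unfolding groupwise_dense_def
  proof (intro conjI allI ballI impI)
    fix A assume "A \<in> \<I>" then show "infinite A" by (simp add: \<I>_def)
  next
    fix A A' assume "A' \<subseteq> A \<and> A \<in> \<I> \<and> infinite A'"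
    then show "A' \<in> \<I>" using dn by (auto simp: \<I>_def)
  next
    fix m :: "nat \<Rightarrow> nat" assume m: "strict_mono m"
    define S where "S = (\<lambda>U. \<Union>i\<in>U. {m i..<m (Suc i)})"
    have inf: "infinite (S U)" if "infinite U" for U
    proof -
      have "m ` U \<subseteq> S U" using m by (auto simp: S_def strict_mono_def)
      moreover have "infinite (m ` U)"
        using that m by (meson finite_imageD inj_on_subset strict_mono_imp_inj_on subset_UNIV)
      ultimately show ?thesis using finite_subset by blast
    qed
    have disj: "i = k" if "x \<in> {m i..<m (Suc i)}" "x \<in> {m k..<m (Suc k)}" for x i k
    proof -
      have "m i < m (Suc k)" "m k < m (Suc i)" using that by auto
      then show ?thesis using m by (simp add: strict_mono_less)
    qed
    have "S {i. even i} \<inter> S {i. odd i} = {}"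
    proof (rule equals0I)
      fix x assume "x \<in> S {i. even i} \<inter> S {i. odd i}"
      then obtain i k where "even i" "odd k" "x \<in> {m i..<m (Suc i)}" "x \<in> {m k..<m (Suc k)}"
        unfolding S_def by blast
      then show False using disj by blast
    qed
    then have "S {i. even i} \<in> J \<or> S {i. odd i} \<in> J" by (rule prime)
    moreover have "infinite {i::nat. even i}"
    proof -
      have "range (\<lambda>n::nat. 2 * n) \<subseteq> {i. even i}" by auto
      moreover have "infinite (range (\<lambda>n::nat. 2 * n))"
        by (simp add: finite_image_iff inj_on_def)
      ultimately show ?thesis using finite_subset by blast
    qed
    moreover have "infinite {i::nat. odd i}"
    proof -
      have "range (\<lambda>n::nat. Suc (2 * n)) \<subseteq> {i. odd i}" by auto
      moreover have "infinite (range (\<lambda>n::nat. Suc (2 * n)))"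
        by (simp add: finite_image_iff inj_on_def)
      ultimately show ?thesis using finite_subset by blast
    qed
    moreover have "S U \<in> \<I>" if "S U \<in> J" "infinite U" for U
      using that inf by (simp add: \<I>_def)
    ultimately have "\<exists>U. infinite U \<and> S U \<in> \<I>" by meson
    then show "\<exists>U. infinite U \<and> (\<Union>i\<in>U. {m i..<m (Suc i)}) \<in> \<I>"
      unfolding S_def .
  qed
  moreover have "\<I> \<union> {A. finite A} = J" using fin by (auto simp: \<I>_def)
  then have "ideal_of_subsets (\<I> \<union> {A. finite A})" using JP by (simp add: P_def)
  moreover have "\<not> B \<subseteq>\<^sup>* A" if "A \<in> \<I>" for A
  proof
    assume "B \<subseteq>\<^sup>* A"
    then have "A \<union> (B - A) \<in> J"
      using that un[of A "B - A"] fin[of "B - A"] unfolding almost_subset_def \<I>_def by blast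
    moreover have "B \<subseteq> A \<union> (B - A)" by blast
    ultimately show False using dn[of B] BJ by metis
  qed
  ultimately have "groupwise_dense_ideal \<I> \<and> (\<forall>A\<in>\<I>. \<not> B \<subseteq>\<^sup>* A)"
    by (simp add: groupwise_dense_ideal_def)
  then show ?thesis ..
qed

lemma gf_sequence_range:
  assumes "gf_sequence \<theta> \<I>"
  shows "gf_sequence |\<I> ` Field \<theta>| id"
  using assms by (simp add: gf_sequence_def Field_card_of)

lemma gf_is_min:
  shows "Card_order gf" "\<exists>\<I>. gf_sequence gf \<I>"
    and "\<And>(\<theta> :: 'i rel) \<I>. Card_order \<theta> \<Longrightarrow> gf_sequence \<theta> \<I> \<Longrightarrow> gf \<le>o \<theta>"
proof -
  let ?R = "{\<theta> :: nat set set rel. Card_order \<theta> \<and> (\<exists>\<I>. gf_sequence \<theta> \<I>)}"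
  have "gf_sequence |{\<I>. groupwise_dense_ideal \<I>}| id"
    using ex_groupwise_dense_ideal_avoiding by (simp add: gf_sequence_def Field_card_of)
  then have "?R \<noteq> {}" using card_of_Card_order by blast
  then have R: "min_card ?R \<in> ?R \<and> (\<forall>s\<in>?R. min_card ?R \<le>o s)"
    by (intro min_card_is_min) auto
  then show "Card_order gf" "\<exists>\<I>. gf_sequence gf \<I>" unfolding gf_def by auto
  fix \<theta> :: "'i rel" and \<I> assume \<theta>: "Card_order \<theta>" "gf_sequence \<theta> \<I>"
  have "|\<I> ` Field \<theta>| \<in> ?R"
    using gf_sequence_range[OF \<theta>(2)] card_of_Card_order by blast
  then have "gf \<le>o |\<I> ` Field \<theta>|" using R unfolding gf_def by blast
  also have "|\<I> ` Field \<theta>| \<le>o |Field \<theta>|" by (rule card_of_image)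
  also have "|Field \<theta>| =o \<theta>" using \<theta>(1) by (rule card_of_Field_ordIso)
  finally show "gf \<le>o \<theta>" .
qed

lemma gf_sequence_proper:
  assumes "gf_sequence \<theta> \<I>"
  shows "\<exists>\<I>'. gf_sequence \<theta> \<I>' \<and> (\<forall>\<alpha>\<in>Field \<theta>. UNIV \<notin> \<I>' \<alpha>)"
proof -
  obtain \<beta> where \<beta>: "\<beta> \<in> Field \<theta>" "UNIV \<notin> \<I> \<beta>"
    using assms infinite_UNIV_nat unfolding gf_sequence_def almost_subset_def
    by (metis Diff_cancel finite.emptyI)
  let ?\<I>' = "\<lambda>\<alpha>. if UNIV \<in> \<I> \<alpha> then \<I> \<beta> else \<I> \<alpha>"
  have "gf_sequence \<theta> ?\<I>'"
    unfolding gf_sequence_def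
  proof (intro conjI ballI allI impI)
    fix \<alpha> assume "\<alpha> \<in> Field \<theta>"
    then show "groupwise_dense_ideal (if UNIV \<in> \<I> \<alpha> then \<I> \<beta> else \<I> \<alpha>)"
      using assms \<beta> by (simp add: gf_sequence_def)
  next
    fix B :: "nat set" assume "infinite B"
    then obtain \<alpha> where \<alpha>: "\<alpha> \<in> Field \<theta>" "\<forall>A\<in>\<I> \<alpha>. \<not> B \<subseteq>\<^sup>* A"
      using assms unfolding gf_sequence_def by blast
    then have "UNIV \<notin> \<I> \<alpha>" by (auto simp: almost_subset_def)
    with \<alpha> show "\<exists>\<alpha>\<in>Field \<theta>. \<forall>A\<in>(if UNIV \<in> \<I> \<alpha> then \<I> \<beta> else \<I> \<alpha>). \<not> B \<subseteq>\<^sup>* A"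
      by (intro bexI[of _ \<alpha>]) auto
  qed
  moreover have "\<forall>\<alpha>\<in>Field \<theta>. UNIV \<notin> ?\<I>' \<alpha>" using \<beta>(2) by simp
  ultimately show ?thesis by blast
qed

end

theory Submission
  imports Defs "HOL-Library.Countable_Set" "HOL-Library.Infinite_Set"
begin

text \<open>
  Fix an unbounded family \<open>F\<close> of size \<open>\<bb>\<close> and a family \<open>\<DD>\<close> of dense open families of infinite sets
  without a common member, of least cardinality; this cardinality is at most \<open>\<bb>\<close>.  As in the base tree
  theorem, \<open>\<DD>\<close> yields \<open>|\<DD>|\<close> many almost disjoint families \<open>\<B> \<delta>\<close> such that every infinite set meets
  continuum many members of one of them.  If the continuum is at most \<open>\<bb>\<^sup>+\<close>, then the ideals avoiding
  the single infinite sets are few enough.  Otherwise each \<open>\<B> \<delta>\<close> can be coloured with \<open>\<bb>\<^sup>+\<close> colours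
  such that every infinite set meets, for some \<open>\<delta>\<close>, members of all colours.  The \<open>\<xi>\<close>-th ideal is generated by
  the unions of blocks of the interval partition of some \<open>f \<in> F\<close>, taken along sets of colour \<open>\<xi>\<close>.  It is
  groupwise dense as \<open>F\<close> is unbounded.  If \<open>B\<close> is almost contained in a member of each ideal, then
  infinitely many colours use the same finite set of pairs \<open>(f, \<delta>)\<close>; by the pigeonhole principle
  almost every element of \<open>B\<close> lies in the blocks of one \<open>f\<close> along two almost disjoint sets, so \<open>B\<close> is finite.
\<close>

section \<open>Dense open families of infinite sets\<close>

lemma almost_subset_trans: "A \<subseteq>\<^sup>* B \<Longrightarrow> B \<subseteq>\<^sup>* C \<Longrightarrow> A \<subseteq>\<^sup>* C"
  unfolding almost_subset_def
  by (rule finite_subset[of _ "(A - B) \<union> (B - C)"]) auto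

lemma subset_imp_almost_subset: "A \<subseteq> B \<Longrightarrow> A \<subseteq>\<^sup>* B"
  unfolding almost_subset_def by (simp add: Diff_eq_empty_iff[THEN iffD2])

lemma almost_subset_infinite_Int:
  assumes "infinite A" "A \<subseteq>\<^sup>* B"
  shows "infinite (A \<inter> B)"
  using assms unfolding almost_subset_def by (metis Un_Diff_Int finite_UnI)

lemma infinite_Int_almost_subset:
  assumes "infinite (A \<inter> C)" "A \<subseteq>\<^sup>* B"
  shows "infinite (B \<inter> C)"
proof -
  have "A \<inter> C \<subseteq> (A - B) \<union> (B \<inter> C)" by blast
  then show ?thesis
    using assms unfolding almost_subset_def by (meson finite_UnI finite_subset)
qed

text \<open>Diagonalise: a strictly increasing choice \<open>a n\<close> in \<open>A n\<close> has a
  range that can leave \<open>A n\<close> only at its first \<open>n\<close> terms, because the sets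
  decrease.\<close>

lemma pseudo_intersection:
  fixes A :: "nat \<Rightarrow> nat set"
  assumes "\<And>n. infinite (A n)" "\<And>n. A (Suc n) \<subseteq> A n"
  shows "\<exists>B. infinite B \<and> B \<subseteq> A 0 \<and> (\<forall>n. B \<subseteq>\<^sup>* A n)"
proof -
  have "\<exists>a. \<forall>n. a n \<in> A n \<and> a n < a (Suc n)"
  proof (rule dependent_nat_choice)
    show "\<exists>x. x \<in> A 0" using assms(1)[of 0] by (metis finite.emptyI ex_in_conv)
    show "\<exists>y. y \<in> A (Suc n) \<and> x < y" for x n
      using assms(1)[of "Suc n"] unfolding infinite_nat_iff_unbounded by blast
  qed
  then obtain a where a: "\<And>n. a n \<in> A n" "\<And>n. a n < a (Suc n)" by blast
  have mono: "A n \<subseteq> A k" if "k \<le> n" for k n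
    using assms(2) that by (rule lift_Suc_antimono_le)
  have "infinite (range a)"
    using a(2) by (meson finite_imageD infinite_UNIV_nat strict_mono_Suc_iff strict_mono_imp_inj_on)
  moreover have "range a \<subseteq> A 0" using a(1) mono by blast
  moreover have "range a \<subseteq>\<^sup>* A n" for n
  proof -
    have "a k \<in> a ` {..<n}" if "a k \<notin> A n" for k
      using that mono[of n k] a(1)[of k] by (cases "n \<le> k") auto
    then have "range a - A n \<subseteq> a ` {..<n}" by blast
    then show ?thesis unfolding almost_subset_def by (rule finite_subset) simp
  qed
  ultimately show ?thesis by blast
qed

text \<open>Density and openness refer to the forcing order of infinite sets under almost inclusion.
  The least number of such families without a common member is the distributivity number
  \<h>.\<close>

definition dense_open :: "nat set set \<Rightarrow> bool" where
  "dense_open D \<longleftrightarrow> (\<forall>A\<in>D. infinite A) \<and> (\<forall>A\<in>D. \<forall>B. infinite B \<and> B \<subseteq>\<^sup>* A \<longrightarrow> B \<in> D) \<and>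
     (\<forall>K. infinite K \<longrightarrow> (\<exists>A\<in>D. A \<subseteq> K))"

lemma dense_openD:
  assumes "dense_open D"
  shows "A \<in> D \<Longrightarrow> infinite A" "A \<in> D \<Longrightarrow> infinite B \<Longrightarrow> B \<subseteq>\<^sup>* A \<Longrightarrow> B \<in> D"
    "infinite K \<Longrightarrow> \<exists>A\<in>D. A \<subseteq> K"
  using assms unfolding dense_open_def by blast+

text \<open>The order is \<sigma>-closed: descend through the families one after the other and take
  a pseudo-intersection, which belongs to each family by openness.\<close>

lemma countable_dense_open_inter:
  assumes "countable \<DD>" "\<And>D. D \<in> \<DD> \<Longrightarrow> dense_open D"
  shows "\<exists>A. infinite A \<and> (\<forall>D\<in>\<DD>. A \<in> D)"
proof (cases "\<DD> = {}")
  case False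
  define D where "D = from_nat_into \<DD>"
  have D: "dense_open (D n)" for n
    unfolding D_def using False by (intro assms(2) from_nat_into)
  have "\<exists>A. \<forall>n. A n \<in> D n \<and> A (Suc n) \<subseteq> A n"
  proof (rule dependent_nat_choice)
    show "\<exists>x. x \<in> D 0" using dense_openD(3)[OF D infinite_UNIV_nat] by blast
    show "\<exists>y. y \<in> D (Suc n) \<and> y \<subseteq> x" if "x \<in> D n" for x n
      using dense_openD(3)[OF D dense_openD(1)[OF D that]] by blast
  qed
  then obtain A where A: "\<And>n. A n \<in> D n" "\<And>n. A (Suc n) \<subseteq> A n" by blast
  obtain B where B: "infinite B" "\<And>n. B \<subseteq>\<^sup>* A n"
    using pseudo_intersection[of A] A(2) dense_openD(1)[OF D A(1)] by blast
  have "B \<in> D n" for n using dense_openD(2)[OF D A(1)] B by blast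
  moreover have "\<exists>n. E = D n" if "E \<in> \<DD>" for E
    unfolding D_def using from_nat_into_surj[OF assms(1) that] by blast
  ultimately show ?thesis using B(1) by blast
qed (use infinite_UNIV_nat in blast)

section \<open>Maximal almost disjoint families\<close>

definition almost_disjoint :: "nat set set \<Rightarrow> bool" where
  "almost_disjoint \<A> \<longleftrightarrow> (\<forall>A\<in>\<A>. infinite A) \<and> (\<forall>A\<in>\<A>. \<forall>B\<in>\<A>. A \<noteq> B \<longrightarrow> finite (A \<inter> B))"

definition mad :: "nat set set \<Rightarrow> bool" where
  "mad \<A> \<longleftrightarrow> almost_disjoint \<A> \<and> (\<forall>K. infinite K \<longrightarrow> (\<exists>A\<in>\<A>. infinite (A \<inter> K)))"

text \<open>Zorn gives an almost disjoint subfamily that is maximal within \<open>D\<close>. It is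
  maximal outright: an infinite \<open>K\<close> almost disjoint from all its members would contain
  some element of \<open>D\<close>, which could be added.\<close>

lemma mad_in_dense_open:
  assumes D: "dense_open D"
  shows "\<exists>\<A>. \<A> \<subseteq> D \<and> mad \<A>"
proof -
  define P where "P = {\<A>. \<A> \<subseteq> D \<and> almost_disjoint \<A>}"
  have "\<exists>M\<in>P. \<forall>X\<in>P. M \<subseteq> X \<longrightarrow> X = M"
  proof (rule subset_Zorn')
    fix C assume C: "subset.chain P C"
    then have CP: "C \<subseteq> P" and ch: "\<And>X Y. X \<in> C \<Longrightarrow> Y \<in> C \<Longrightarrow> X \<subseteq> Y \<or> Y \<subseteq> X"
      by (auto simp: subset_chain_def)
    have "finite (A \<inter> B)" if AB: "A \<in> \<Union>C" "B \<in> \<Union>C" "A \<noteq> B" for A B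
    proof -
      obtain X Y where XY: "X \<in> C" "Y \<in> C" "A \<in> X" "B \<in> Y" using AB by blast
      obtain Z where "Z \<in> C" "A \<in> Z" "B \<in> Z" using ch[OF XY(1,2)] XY by blast
      then show ?thesis using CP AB(3) unfolding P_def almost_disjoint_def by blast
    qed
    moreover have "\<Union>C \<subseteq> D" using CP by (auto simp: P_def)
    ultimately show "\<Union>C \<in> P"
      using dense_openD(1)[OF D] unfolding P_def almost_disjoint_def by blast
  qed
  then obtain \<A> where A: "\<A> \<in> P" and max: "\<And>X. X \<in> P \<Longrightarrow> \<A> \<subseteq> X \<Longrightarrow> X = \<A>" by blast
  have "\<exists>A\<in>\<A>. infinite (A \<inter> K)" if K: "infinite K" for K
  proof (rule ccontr)
    assume neg: "\<not> ?thesis"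
    obtain B where B: "B \<in> D" "B \<subseteq> K" using dense_openD(3)[OF D K] by blast
    have "finite (A \<inter> B)" if "A \<in> \<A>" for A
      using neg B(2) that by (meson Int_mono finite_subset order_refl)
    then have "insert B \<A> \<in> P"
      using A B(1) dense_openD(1)[OF D B(1)] unfolding P_def almost_disjoint_def
      by (auto simp: Int_commute)
    then have "B \<in> \<A>" using max by blast
    then show False using neg B dense_openD(1)[OF D B(1)] by (metis inf.absorb1)
  qed
  then show ?thesis using A unfolding P_def mad_def by blast
qed

text \<open>This leads from a mad family back to a dense open one, so that refining several mad
  families at once becomes an intersection of dense open families.\<close>

definition refining :: "nat set set \<Rightarrow> nat set set" where
  "refining \<A> = {L. infinite L \<and> (\<exists>A\<in>\<A>. L \<subseteq>\<^sup>* A)}"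

lemma dense_open_refining:
  assumes "mad \<A>"
  shows "dense_open (refining \<A>)"
  unfolding dense_open_def
proof (intro conjI ballI allI impI)
  fix A assume "A \<in> refining \<A>" then show "infinite A" by (simp add: refining_def)
next
  fix A B assume "A \<in> refining \<A>" "infinite B \<and> B \<subseteq>\<^sup>* A"
  then show "B \<in> refining \<A>" unfolding refining_def using almost_subset_trans by blast
next
  fix K :: "nat set" assume "infinite K"
  then obtain A where "A \<in> \<A>" "infinite (A \<inter> K)" using assms unfolding mad_def by blast
  then show "\<exists>L\<in>refining \<A>. L \<subseteq> K"
    unfolding refining_def using subset_imp_almost_subset[of "A \<inter> K" A]
    by (intro bexI[of _ "A \<inter> K"]) auto
qed

text \<open>If \<open>L\<close> meets \<open>A\<close> in an infinite set, then \<open>L - A\<close>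
  is infinite too, since otherwise openness would put \<open>L\<close> into \<open>D\<close>. So a
  second member of the mad family meets \<open>L - A\<close>.\<close>

lemma mad_splits:
  assumes D: "dense_open D" and \<A>: "\<A> \<subseteq> D" "mad \<A>" and L: "infinite L" "L \<notin> D"
  shows "\<exists>A\<in>\<A>. \<exists>A'\<in>\<A>. A \<noteq> A' \<and> infinite (L \<inter> A) \<and> infinite (L \<inter> A')"
proof -
  obtain A where A: "A \<in> \<A>" "infinite (A \<inter> L)"
    using \<A>(2) L(1) unfolding mad_def by blast
  have "infinite (L - A)"
    using dense_openD(2)[OF D, of A L] A(1) \<A>(1) L unfolding almost_subset_def by blast
  then obtain A' where A': "A' \<in> \<A>" "infinite (A' \<inter> (L - A))"
    using \<A>(2) unfolding mad_def by blast
  have "A \<noteq> A'"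
  proof
    assume "A = A'"
    then have "A' \<inter> (L - A) = {}" by blast
    then show False using A'(2) by simp
  qed
  moreover have "infinite (L \<inter> A')"
    using A'(2) by (rule contrapos_nn) (rule finite_subset, auto)
  ultimately show ?thesis using A A'(1) by (auto simp: Int_commute)
qed

section \<open>Sparse sets, and the inequality between \<h> and the unbounded number\<close>

definition growing :: "(nat \<Rightarrow> nat) \<Rightarrow> nat set set" where
  "growing f = {A. infinite A \<and> (\<exists>N. \<forall>a\<in>A. \<forall>b\<in>A. N < a \<longrightarrow> a < b \<longrightarrow> (\<forall>n\<le>a. f n \<le> b))}"

lemma dense_open_growing: "dense_open (growing f)"
  unfolding dense_open_def
proof (intro conjI ballI allI impI)
  fix A assume "A \<in> growing f" then show "infinite A" by (simp add: growing_def)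
next
  fix A B assume A: "A \<in> growing f" and B: "infinite B \<and> B \<subseteq>\<^sup>* A"
  then obtain N where N: "\<And>a b n. a \<in> A \<Longrightarrow> b \<in> A \<Longrightarrow> N < a \<Longrightarrow> a < b \<Longrightarrow> n \<le> a \<Longrightarrow> f n \<le> b"
    unfolding growing_def by blast
  obtain M where "\<forall>x\<in>B - A. x \<le> M"
    using B unfolding almost_subset_def finite_nat_set_iff_bounded_le by blast
  then have M: "x \<in> A" if "x \<in> B" "M < x" for x using that by force
  have "f n \<le> b" if "a \<in> B" "b \<in> B" "max N M < a" "a < b" "n \<le> a" for a b n
    using N[of a b n] M[of a] M[of b] that by simp
  then show "B \<in> growing f" using B unfolding growing_def by blast
next
  fix K :: "nat set" assume K: "infinite K"
  have "\<exists>a. \<forall>i. a i \<in> K \<and> (a i < a (Suc i) \<and> (\<forall>n\<le>a i. f n \<le> a (Suc i)))"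
  proof (rule dependent_nat_choice)
    show "\<exists>x. x \<in> K" using K by (metis finite.emptyI ex_in_conv)
    fix x i :: nat
    \<comment> \<open>The sum dominates all the values \<open>f n\<close> with
      \<open>n \<le> x\<close> at once.\<close>
    obtain y where y: "y \<in> K" "x + (\<Sum>n\<le>x. f n) < y"
      using K unfolding infinite_nat_iff_unbounded by blast
    have "f n \<le> (\<Sum>n\<le>x. f n)" if "n \<le> x" for n
      using that by (intro member_le_sum) auto
    then have "\<forall>n\<le>x. f n \<le> y" using y(2) by fastforce
    then show "\<exists>y. y \<in> K \<and> (x < y \<and> (\<forall>n\<le>x. f n \<le> y))" using y by (intro exI[of _ y]) simp
  qed
  then obtain a where a: "\<And>i. a i \<in> K" "\<And>i. a i < a (Suc i)" "\<And>i n. n \<le> a i \<Longrightarrow> f n \<le> a (Suc i)"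
    by blast
  have sm: "strict_mono a" using a(2) by (simp add: strict_mono_Suc_iff)
  have "f n \<le> a j" if "a i < a j" "n \<le> a i" for n i j
  proof -
    have "a (Suc i) \<le> a j" using that(1) sm by (simp add: strict_mono_less strict_mono_less_eq)
    then show ?thesis using a(3)[OF that(2)] by simp
  qed
  moreover have "infinite (range a)"
    using sm by (meson finite_imageD infinite_UNIV_nat strict_mono_imp_inj_on)
  ultimately have "range a \<in> growing f" unfolding growing_def by blast
  then show "\<exists>A\<in>growing f. A \<subseteq> K" using a(1) by blast
qed

text \<open>A common member \<open>A\<close> would be sparse for every \<open>f\<close> in
  \<open>F\<close>, and moving twice upwards inside \<open>A\<close> would then bound all of
  \<open>F\<close>.\<close>

lemma growing_no_common:
  assumes "\<not> has_upper_bound F"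
  shows "\<not> (\<exists>A. \<forall>D\<in>growing ` F. A \<in> D)"
proof
  assume "\<exists>A. \<forall>D\<in>growing ` F. A \<in> D"
  then obtain A where A: "\<And>f. f \<in> F \<Longrightarrow> A \<in> growing f" by blast
  obtain f0 where "f0 \<in> F" using assms by (auto simp: has_upper_bound_def)
  then have "infinite A" using A by (auto simp: growing_def)
  then have "\<exists>a\<in>A. n < a" for n unfolding infinite_nat_iff_unbounded by blast
  then obtain h where h: "\<And>n. h n \<in> A" "\<And>n. n < h n" by metis
  \<comment> \<open>The inner \<open>h\<close> reaches an element of \<open>A\<close> above
    \<open>n\<close>; the outer one reaches a later element, which by sparseness is at least
    \<open>f n\<close>.\<close>
  have "le_bd f (\<lambda>n. h (h n))" if f: "f \<in> F" for f
  proof -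
    obtain N where "\<And>a b n. a \<in> A \<Longrightarrow> b \<in> A \<Longrightarrow> N < a \<Longrightarrow> a < b \<Longrightarrow> n \<le> a \<Longrightarrow> f n \<le> b"
      using A[OF f] unfolding growing_def by blast
    then have "f n \<le> h (h n)" if "n > N" for n
      using h that by (meson less_imp_le order_less_trans)
    then show ?thesis unfolding le_bd_def by blast
  qed
  then show False using assms unfolding has_upper_bound_def by blast
qed

section \<open>Homogeneity and intersections of few dense open families\<close>

lemma dense_open_pullback:
  assumes D: "dense_open D" and e: "inj (e :: nat \<Rightarrow> nat)"
  shows "dense_open {A. infinite A \<and> e ` A \<in> D}"
  unfolding dense_open_def
proof (intro conjI ballI allI impI)
  fix A B assume A: "A \<in> {A. infinite A \<and> e ` A \<in> D}" and B: "infinite B \<and> B \<subseteq>\<^sup>* A"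
  have "e ` B - e ` A \<subseteq> e ` (B - A)" by blast
  then have "e ` B \<subseteq>\<^sup>* e ` A"
    using B unfolding almost_subset_def by (meson finite_imageI finite_subset)
  moreover have "infinite (e ` B)" using B e by (meson finite_imageD inj_on_subset subset_UNIV)
  ultimately show "B \<in> {A. infinite A \<and> e ` A \<in> D}"
    using A B dense_openD(2)[OF D] by blast
next
  fix K :: "nat set" assume "infinite K"
  then have "infinite (e ` K)" using e by (meson finite_imageD inj_on_subset subset_UNIV)
  then obtain A where A: "A \<in> D" "A \<subseteq> e ` K" using dense_openD(3)[OF D] by blast
  have eq: "e ` (e -` A) = A" using A(2) by blast
  then have "infinite (e -` A)" using dense_openD(1)[OF D A(1)] by (metis finite_imageI)
  moreover have "e -` A \<subseteq> K" using A(2) e by (auto dest: injD)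
  ultimately show "\<exists>A\<in>{A. infinite A \<and> e ` A \<in> D}. A \<subseteq> K" using A(1) eq by auto
qed auto

text \<open>Minimality yields just one common member, whereas density needs one below each
  \<open>K\<close>. Enumerating \<open>K\<close> identifies its subsets with the subsets of
  \<omega>: a common member of the pulled back families is carried into \<open>K\<close>.\<close>

lemma ordLess_dense_open_inter:
  fixes \<DD> :: "nat set set set" and \<EE> :: "nat set set set"
  assumes min: "\<And>\<EE>. (\<forall>D\<in>\<EE>. dense_open D) \<Longrightarrow> \<not> (\<exists>A. \<forall>D\<in>\<EE>. A \<in> D) \<Longrightarrow> |\<DD>| \<le>o |\<EE>|"
    and \<EE>: "\<And>D. D \<in> \<EE> \<Longrightarrow> dense_open D" "|\<EE>| <o |\<DD>|"
  shows "dense_open {A. infinite A \<and> (\<forall>D\<in>\<EE>. A \<in> D)}"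
  unfolding dense_open_def
proof (intro conjI ballI allI impI)
  fix A B assume "A \<in> {A. infinite A \<and> (\<forall>D\<in>\<EE>. A \<in> D)}" "infinite B \<and> B \<subseteq>\<^sup>* A"
  then show "B \<in> {A. infinite A \<and> (\<forall>D\<in>\<EE>. A \<in> D)}"
    using dense_openD(2)[OF \<EE>(1)] by blast
next
  fix K :: "nat set" assume K: "infinite K"
  define e where "e = enumerate K"
  have e: "inj e" "range e = K"
    using K bij_enumerate[of K] unfolding e_def bij_betw_def by auto
  define \<EE>' where "\<EE>' = (\<lambda>D. {A. infinite A \<and> e ` A \<in> D}) ` \<EE>"
  have "|\<EE>'| \<le>o |\<EE>|" unfolding \<EE>'_def by (rule card_of_image)
  then have "\<not> |\<DD>| \<le>o |\<EE>'|"
    using \<EE>(2) not_ordLess_ordLeq ordLeq_transitive by blast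
  moreover have "\<forall>D\<in>\<EE>'. dense_open D"
    unfolding \<EE>'_def using dense_open_pullback[OF \<EE>(1) e(1)] by blast
  ultimately have "\<exists>A. \<forall>D\<in>\<EE>'. A \<in> D" using min[of \<EE>'] by metis
  then obtain A where A: "\<forall>D\<in>\<EE>'. A \<in> D" ..
  show "\<exists>A\<in>{A. infinite A \<and> (\<forall>D\<in>\<EE>. A \<in> D)}. A \<subseteq> K"
  \<comment> \<open>With no families, nothing is known about \<open>A\<close>, not even that it is
    infinite, so \<open>K\<close> itself is taken.\<close>
  proof (cases "\<EE> = {}")
    case True
    then show ?thesis using K by blast
  next
    case False
    have *: "infinite A \<and> e ` A \<in> D" if "D \<in> \<EE>" for D using A that by (simp add: \<EE>'_def)
    then have "infinite (e ` A)" using False dense_openD(1)[OF \<EE>(1)] by blast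
    then show ?thesis using * e(2) by blast
  qed
qed auto

text \<open>The families \<open>growing f\<close> show that the class of candidates is nonempty and
  that its minimum is at most \<open>|F|\<close>; the minimum is infinite because countably many
  dense open families have a common member.\<close>

lemma minimal_family:
  assumes F: "\<not> has_upper_bound F"
  obtains \<DD> :: "nat set set set"
  where "\<And>D. D \<in> \<DD> \<Longrightarrow> dense_open D" "\<not> (\<exists>A. \<forall>D\<in>\<DD>. A \<in> D)" "|\<DD>| \<le>o |F|" "infinite \<DD>"
    "\<And>\<EE>. (\<And>D. D \<in> \<EE> \<Longrightarrow> dense_open D) \<Longrightarrow> |\<EE>| <o |\<DD>| \<Longrightarrow>
       dense_open {A. infinite A \<and> (\<forall>D\<in>\<EE>. A \<in> D)}"
proof -
  define P where "P = (\<lambda>\<EE>. (\<forall>D\<in>\<EE>. dense_open D) \<and> \<not> (\<exists>A. \<forall>D\<in>\<EE>. A \<in> D))"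
  define R where "R = {|\<EE>| | \<EE>. P \<EE>}"
  have F': "P (growing ` F)"
    using growing_no_common[OF F] dense_open_growing unfolding P_def by blast
  then have "R \<noteq> {}" "\<forall>r\<in>R. Card_order r"
    unfolding R_def by (auto simp: card_of_Card_order)
  then obtain \<DD> where D: "P \<DD>" and min: "\<And>\<EE>. P \<EE> \<Longrightarrow> |\<DD>| \<le>o |\<EE>|"
    using exists_minim_Card_order[of R] unfolding R_def by blast
  show ?thesis
  proof (rule that)
    show "\<And>D. D \<in> \<DD> \<Longrightarrow> dense_open D" "\<not> (\<exists>A. \<forall>D\<in>\<DD>. A \<in> D)" using D unfolding P_def by auto
    show "|\<DD>| \<le>o |F|" using min[OF F'] card_of_image ordLeq_transitive by blast
    show "infinite \<DD>"
    proof
      assume "finite \<DD>"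
      then show False
        using countable_dense_open_inter[of \<DD>] D unfolding P_def by (auto dest: countable_finite)
    qed
    show "dense_open {A. infinite A \<and> (\<forall>D\<in>\<EE>. A \<in> D)}"
      if "\<And>D. D \<in> \<EE> \<Longrightarrow> dense_open D" "|\<EE>| <o |\<DD>|" for \<EE>
      using that min unfolding P_def by (intro ordLess_dense_open_inter[of \<DD>]) auto
  qed
qed

section \<open>A base tree\<close>

text \<open>Proper initial segments of a cardinal are smaller, and adding the point \<open>a\<close>
  to one does not reach an infinite cardinal. Intersections along such segments of
  \<open>|\<DD>|\<close> thus remain dense open.\<close>

lemma card_of_under_ordLess:
  assumes r: "Card_order r" "infinite (Field r)" "a \<in> Field r"
  shows "|under r a| <o |Field r|"
proof -
  have r': "r =o |Field r|" using card_of_Field_ordIso[OF r(1)] by (rule ordIso_symmetric)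
  have "|underS r a| <o |Field r|"
    using card_of_underS[OF r(1,3)] r' by (rule ordLess_ordIso_trans)
  moreover have "|{a}| <o |Field r|" 
    using r(2) card_of_ordLeq_infinite[of "Field r" "{a}"] 
    by (metis card_of_Well_order finite.emptyI finite.insertI not_ordLeq_iff_ordLess)
  ultimately have "|underS r a \<union> {a}| <o |Field r|"
    using r(2) by (intro card_of_Un_ordLess_infinite)
  moreover have "under r a \<subseteq> underS r a \<union> {a}" unfolding under_def underS_def by blast
  ultimately show ?thesis using card_of_mono1 ordLeq_ordLess_trans by blast
qed

lemma ordLess_image_dense_open_inter:
  fixes \<DD> :: "nat set set set"
  assumes "\<And>\<EE>. (\<And>D. D \<in> \<EE> \<Longrightarrow> dense_open D) \<Longrightarrow> |\<EE>| <o |\<DD>| \<Longrightarrow>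
       dense_open {A. infinite A \<and> (\<forall>D\<in>\<EE>. A \<in> D)}"
    and "\<And>i. i \<in> I \<Longrightarrow> dense_open (G i)" "|I| <o |\<DD>|"
  shows "dense_open {A. infinite A \<and> (\<forall>i\<in>I. A \<in> G i)}"
proof -
  have "|G ` I| <o |\<DD>|" using card_of_image assms(3) by (rule ordLeq_ordLess_trans)
  then have "dense_open {A. infinite A \<and> (\<forall>D\<in>G ` I. A \<in> D)}" using assms(1)[of "G ` I"] assms(2) by blast
  then show ?thesis by simp
qed

text \<open>The first \<open>n\<close> bits of the characteristic function of \<open>X\<close>,
  latest bit first, so that extending a branch is a \<open>Cons\<close>.\<close>

fun branch :: "nat set \<Rightarrow> nat \<Rightarrow> bool list" where
  "branch X 0 = []"
| "branch X (Suc n) = (n \<in> X) # branch X n"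

lemma branch_split:
  assumes "X \<noteq> Y"
  shows "\<exists>n. branch X n = branch Y n \<and> (n \<in> X) \<noteq> (n \<in> Y)"
proof -
  define n where "n = (LEAST n. (n \<in> X) \<noteq> (n \<in> Y))"
  have "\<exists>n. (n \<in> X) \<noteq> (n \<in> Y)" using assms by blast
  then have "(n \<in> X) \<noteq> (n \<in> Y)" unfolding n_def by (rule LeastI_ex)
  moreover have "(m \<in> X) = (m \<in> Y)" if "m < n" for m
    using not_less_Least[of m "\<lambda>n. (n \<in> X) \<noteq> (n \<in> Y)"] that unfolding n_def by simp
  then have "branch X m = branch Y m" if "m \<le> n" for m
    using that by (induction m) simp_all
  ultimately show ?thesis by blast
qed

text \<open>A binary tree of sets below \<open>K\<close>: a node \<open>L\<close> has the two
  children \<open>L \<inter> c b L\<close>, for a bit \<open>b\<close>.\<close>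

fun node :: "nat set \<Rightarrow> (bool \<Rightarrow> nat set \<Rightarrow> nat set) \<Rightarrow> bool list \<Rightarrow> nat set" where
  "node K c [] = K"
| "node K c (b # s) = node K c s \<inter> c b (node K c s)"

text \<open>Every infinite set is split by two members of some mad family
  \<open>\<A> \<delta>\<close>. Iterating this below \<open>K\<close> gives a binary tree that uses
  countably many levels, all below a single \<delta>. Each branch has a pseudo-intersection meeting
  some member of \<open>\<B> \<delta>\<close>; as \<open>\<B> \<delta>\<close> refines all earlier
  levels, this member determines the branch, so continuum many members meet
  \<open>K\<close>.\<close>

lemma base_tree:
  fixes \<DD> :: "nat set set set"
  assumes D: "\<And>D. D \<in> \<DD> \<Longrightarrow> dense_open D" and no_common: "\<not> (\<exists>A. \<forall>D\<in>\<DD>. A \<in> D)"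
    and inf: "infinite \<DD>"
    and inter: "\<And>\<EE>. (\<And>D. D \<in> \<EE> \<Longrightarrow> dense_open D) \<Longrightarrow> |\<EE>| <o |\<DD>| \<Longrightarrow>
       dense_open {A. infinite A \<and> (\<forall>D\<in>\<EE>. A \<in> D)}"
  obtains \<B> :: "nat set set \<Rightarrow> nat set set"
  where "\<And>\<delta>. \<delta> \<in> \<DD> \<Longrightarrow> almost_disjoint (\<B> \<delta>)"
    "\<And>K. infinite K \<Longrightarrow> \<exists>\<delta>\<in>\<DD>. |UNIV :: nat set set| \<le>o |{B\<in>\<B> \<delta>. infinite (B \<inter> K)}|"
proof -
  define u where "u = under |\<DD>|"
  have u_less: "|u \<delta>| <o |\<DD>|" if "\<delta> \<in> \<DD>" for \<delta>
    using card_of_under_ordLess[of "|\<DD>|" \<delta>] that inf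
    unfolding u_def by (simp add: card_of_card_order_on Field_card_of)
  have wo: "Well_order |\<DD>|" by (rule card_of_Well_order)
  have u_sub: "u \<delta> \<subseteq> \<DD>" for \<delta>
    unfolding u_def under_def by (auto dest: FieldI1 simp: Field_card_of)
  have u_refl: "\<delta> \<in> u \<delta>" if "\<delta> \<in> \<DD>" for \<delta>
    using wo that unfolding u_def under_def order_on_defs refl_on_def by (auto simp: Field_card_of)
  have u_total: "\<epsilon> \<in> u \<delta>" if "\<delta> \<in> \<DD>" "\<epsilon> \<in> \<DD>" "\<delta> \<notin> u \<epsilon>" for \<delta> \<epsilon>
    using wo that u_refl unfolding u_def under_def order_on_defs total_on_def
    by (cases "\<delta> = \<epsilon>") (auto simp: Field_card_of)
  define E where "E \<delta> = {A. infinite A \<and> (\<forall>D\<in>u \<delta>. A \<in> D)}" for \<delta>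
  have E: "dense_open (E \<delta>)" if "\<delta> \<in> \<DD>" for \<delta>
    unfolding E_def using u_less[OF that] D u_sub by (intro inter) auto
  obtain \<A> where \<A>: "\<And>\<delta>. \<delta> \<in> \<DD> \<Longrightarrow> \<A> \<delta> \<subseteq> E \<delta> \<and> mad (\<A> \<delta>)"
    using mad_in_dense_open[OF E] by metis
  \<comment> \<open>A second round is needed: members of \<open>\<A> \<delta>\<close> lie in the
    given families up to \<delta>, but need not refine the mad families chosen at earlier levels.
    Members of \<open>\<B> \<delta>\<close> do.\<close>
  define G where "G \<delta> = {A. infinite A \<and> (\<forall>\<epsilon>\<in>u \<delta>. A \<in> refining (\<A> \<epsilon>))}" for \<delta>
  have G: "dense_open (G \<delta>)" if "\<delta> \<in> \<DD>" for \<delta>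
    unfolding G_def
  proof (rule ordLess_image_dense_open_inter[OF inter _ u_less[OF that]])
    show "dense_open (refining (\<A> \<epsilon>))" if "\<epsilon> \<in> u \<delta>" for \<epsilon>
      using that u_sub \<A> by (intro dense_open_refining) blast
  qed
  obtain \<B> where \<B>: "\<And>\<delta>. \<delta> \<in> \<DD> \<Longrightarrow> \<B> \<delta> \<subseteq> G \<delta> \<and> mad (\<B> \<delta>)"
    using mad_in_dense_open[OF G] by metis
  \<comment> \<open>Some family in \<open>\<DD>\<close> omits \<open>L\<close>, and at that level
    the mad family splits \<open>L\<close>.\<close>
  have "\<exists>\<delta> A A'. \<delta> \<in> \<DD> \<and> A \<in> \<A> \<delta> \<and> A' \<in> \<A> \<delta> \<and> A \<noteq> A' \<and> infinite (L \<inter> A) \<and> infinite (L \<inter> A')"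
    if L: "infinite L" for L
  proof -
    obtain \<delta> where \<delta>: "\<delta> \<in> \<DD>" "L \<notin> \<delta>" using no_common by blast
    then have "L \<notin> E \<delta>" using u_refl unfolding E_def by blast
    then show ?thesis using mad_splits[OF E[OF \<delta>(1)] _ _ L] \<A>[OF \<delta>(1)] \<delta>(1) by metis
  qed
  then obtain d c0 c1 where dc: "\<And>L. infinite L \<Longrightarrow> d L \<in> \<DD> \<and> c0 L \<in> \<A> (d L) \<and> c1 L \<in> \<A> (d L) \<and>
      c0 L \<noteq> c1 L \<and> infinite (L \<inter> c0 L) \<and> infinite (L \<inter> c1 L)"
    by metis
  define c where "c b = (if b then c1 else c0)" for b
  have c: "c b L \<in> \<A> (d L)" "infinite (L \<inter> c b L)" "(c b L = c b' L) = (b = b')"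
    if "infinite L" for b b' L
    using dc[OF that] unfolding c_def by auto
  have "\<exists>\<delta>\<in>\<DD>. |UNIV :: nat set set| \<le>o |{B\<in>\<B> \<delta>. infinite (B \<inter> K)}|" if K: "infinite K" for K
  proof -
    define L where "L = node K c"
    have L: "infinite (L s)" for s
      by (induction s) (use K c(2) in \<open>auto simp: L_def\<close>)
    have dL: "d (L s) \<in> \<DD>" for s using dc[OF L] by blast
    \<comment> \<open>The countably many levels used by the tree are bounded, since otherwise the \<open>E\<close>'s at these
      levels would intersect to the same set as the whole family.\<close>
    have "\<exists>\<delta>\<in>\<DD>. \<forall>s. d (L s) \<in> u \<delta>"
    proof (rule ccontr)
      assume neg: "\<not> ?thesis"
      have "\<exists>A. infinite A \<and> (\<forall>D\<in>range (\<lambda>s. E (d (L s))). A \<in> D)"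
        by (rule countable_dense_open_inter) (use E[OF dL] in auto)
      then obtain A where A: "\<And>s. A \<in> E (d (L s))" by auto
      have "A \<in> \<delta>" if "\<delta> \<in> \<DD>" for \<delta>
      proof -
        obtain s where "d (L s) \<notin> u \<delta>" using neg \<open>\<delta> \<in> \<DD>\<close> by blast
        then have "\<delta> \<in> u (d (L s))" using u_total[OF dL \<open>\<delta> \<in> \<DD>\<close>] by blast
        then show ?thesis using A[of s] unfolding E_def by blast
      qed
      then show False using no_common by blast
    qed
    then obtain \<delta> where \<delta>: "\<delta> \<in> \<DD>" "\<And>s. d (L s) \<in> u \<delta>" by blast
    have "\<exists>P. infinite P \<and> P \<subseteq> K \<and> (\<forall>n. P \<subseteq>\<^sup>* L (branch X n))" for X
      using pseudo_intersection[of "\<lambda>n. L (branch X n)"] L by (auto simp: L_def)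
    then obtain P where P: "\<And>X. infinite (P X)" "\<And>X. P X \<subseteq> K"
      "\<And>X n. P X \<subseteq>\<^sup>* L (branch X n)"
      by metis
    have "\<exists>B\<in>\<B> \<delta>. infinite (B \<inter> P X)" for X
      using \<B>[OF \<delta>(1)] P(1) unfolding mad_def by blast
    then obtain B where B: "\<And>X. B X \<in> \<B> \<delta>" "\<And>X. infinite (B X \<inter> P X)" by metis
    \<comment> \<open>\<open>B X\<close> is almost contained in one member \<open>A\<close> of the
      level at which this node splits. As \<open>P X\<close> meets \<open>B X\<close> in an infinite
      set and is almost contained in the member chosen by the branch, the two members meet
      infinitely and hence coincide.\<close>
    have B_node: "B X \<subseteq>\<^sup>* c (n \<in> X) (L (branch X n))" for X n
    proof -
      define s where "s = branch X n"
      obtain A where A: "A \<in> \<A> (d (L s))" "B X \<subseteq>\<^sup>* A"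
        using \<B>[OF \<delta>(1)] B(1)[of X] \<delta>(2)[of s] unfolding G_def refining_def by blast
      have "P X \<subseteq>\<^sup>* c (n \<in> X) (L s)"
        using almost_subset_trans[OF P(3)[of X "Suc n"] subset_imp_almost_subset, of "c (n \<in> X) (L s)"]
        by (simp add: L_def s_def)
      moreover have "infinite (P X \<inter> A)"
        using infinite_Int_almost_subset[OF B(2) A(2)] by (simp add: Int_commute)
      ultimately have "infinite (c (n \<in> X) (L s) \<inter> A)" by (metis infinite_Int_almost_subset)
      moreover have "almost_disjoint (\<A> (d (L s)))" using \<A>[OF dL] unfolding mad_def by blast
      ultimately have "A = c (n \<in> X) (L s)"
        using A(1) c(1)[OF L] unfolding almost_disjoint_def by blast
      then show ?thesis using A(2) by (simp add: s_def)
    qed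
    \<comment> \<open>Where two branches separate, a common value of \<open>B\<close> would be
      almost contained in two distinct members of one almost disjoint family.\<close>
    have "inj B"
    proof (rule injI, rule ccontr)
      fix X Y assume eq: "B X = B Y" and "X \<noteq> Y"
      then obtain n where n: "branch X n = branch Y n" "(n \<in> X) \<noteq> (n \<in> Y)"
        using branch_split by blast
      define s where "s = branch X n"
      define C C' where "C = c (n \<in> X) (L s)" and "C' = c (n \<in> Y) (L s)"
      have "B X \<subseteq>\<^sup>* C" "B X \<subseteq>\<^sup>* C'"
        using B_node[of X n] B_node[of Y n] n(1) eq by (auto simp: C_def C'_def s_def)
      moreover have "infinite (B X)" using B(2)[of X] by blast
      ultimately have "infinite (C \<inter> C')"
        using almost_subset_infinite_Int infinite_Int_almost_subset by (metis Int_commute)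
      moreover have "C \<noteq> C'" unfolding C_def C'_def using c(3)[OF L] n(2) by simp
      moreover have "C \<in> \<A> (d (L s))" "C' \<in> \<A> (d (L s))"
        unfolding C_def C'_def using c(1)[OF L] by auto
      ultimately show False using \<A>[OF dL, of s] unfolding mad_def almost_disjoint_def by blast
    qed
    moreover have "range B \<subseteq> {B\<in>\<B> \<delta>. infinite (B \<inter> K)}"
    proof -
      have "infinite (B X \<inter> K)" for X
        using B(2)[of X] P(2)[of X] by (meson Int_mono finite_subset order_refl)
      then show ?thesis using B(1) by blast
    qed
    ultimately show ?thesis using \<delta>(1) card_of_ordLeq by blast
  qed
  moreover have "almost_disjoint (\<B> \<delta>)" if "\<delta> \<in> \<DD>" for \<delta> using \<B>[OF that] unfolding mad_def by blast
  ultimately show ?thesis using that by blast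
qed

section \<open>Colourings and counting\<close>

text \<open>Recursion along the well-order \<open>|I|\<close>: at stage \<open>i\<close>, fewer than
  \<open>|I|\<close> values have been used, so \<open>S i\<close> still has a fresh one.\<close>

lemma injective_choice:
  fixes S :: "'i \<Rightarrow> 'a set"
  assumes "\<And>i. i \<in> I \<Longrightarrow> |I| \<le>o |S i|"
  shows "\<exists>f. inj_on f I \<and> (\<forall>i\<in>I. f i \<in> S i)"
proof -
  define R where "R = |I| - Id"
  have wo: "Well_order |I|" by (rule card_of_Well_order)
  define P where "P f x y \<longleftrightarrow> (x \<in> I \<longrightarrow> y \<in> S x \<and> y \<notin> f ` underS |I| x)" for f :: "'i \<Rightarrow> 'a" and x y
  have "\<exists>f. \<forall>x. P f x (f x)"
  proof (rule dependent_wf_choice[of R])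
    show "wf R" using wo unfolding R_def order_on_defs well_order_on_def by blast
    show "P f x y = P g x y" if "\<And>z. (z, x) \<in> R \<Longrightarrow> f z = g z" for f g x y
    proof -
      have "f ` underS |I| x = g ` underS |I| x"
        by (rule image_cong) (use that in \<open>auto simp: R_def underS_def\<close>)
      then show ?thesis by (simp add: P_def)
    qed
    show "\<exists>y. P f x y" for x f
    proof (cases "x \<in> I")
      case True
      have "|f ` underS |I| x| <o |I|"
        using card_of_underS[of "|I|" x] True card_of_image ordLeq_ordLess_trans
        by (metis card_of_Card_order Field_card_of)
      then have "|f ` underS |I| x| <o |S x|" using assms[OF True] by (rule ordLess_ordLeq_trans)
      then have "\<not> S x \<subseteq> f ` underS |I| x" using card_of_mono1 not_ordLess_ordLeq by blast
      then show ?thesis unfolding P_def by blast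
    qed (auto simp: P_def)
  qed
  then obtain f where f: "\<And>x. x \<in> I \<Longrightarrow> f x \<in> S x \<and> f x \<notin> f ` underS |I| x" unfolding P_def by blast
  have "inj_on f I"
  proof (rule inj_onI, rule ccontr)
    fix x y assume xy: "x \<in> I" "y \<in> I" "f x = f y" "x \<noteq> y"
    then have "x \<in> underS |I| y \<or> y \<in> underS |I| x"
      using wo unfolding order_on_defs well_order_on_def total_on_def underS_def
      by (auto simp: Field_card_of)
    then show False using f xy by (metis imageI)
  qed
  then show ?thesis using f by blast
qed

text \<open>For each pair of a set \<open>K\<close> with continuum many candidates and a colour in
  \<open>Y\<close>, choose a candidate, injectively in the pair. There are at most continuum many
  pairs, and injectivity makes the colour classes disjoint.\<close>

lemma colouring:
  fixes \<B> :: "nat set set" and Y :: "'c set"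
  assumes Y: "|Y| \<le>o |UNIV :: nat set set|"
  obtains \<C> :: "'c \<Rightarrow> nat set set"
  where "\<And>\<xi>. \<C> \<xi> \<subseteq> \<B>" "\<And>\<xi> \<zeta>. \<xi> \<noteq> \<zeta> \<Longrightarrow> \<C> \<xi> \<inter> \<C> \<zeta> = {}"
    "\<And>K \<xi>. |UNIV :: nat set set| \<le>o |{B\<in>\<B>. infinite (B \<inter> K)}| \<Longrightarrow> \<xi> \<in> Y \<Longrightarrow>
       \<exists>B\<in>\<C> \<xi>. infinite (B \<inter> K)"
proof -
  define \<K> where "\<K> = {K. |UNIV :: nat set set| \<le>o |{B\<in>\<B>. infinite (B \<inter> K)}|}"
  have "|\<K> \<times> Y| \<le>o |UNIV :: nat set set|"
  proof (rule card_of_Times_ordLeq_infinite_Field[OF _ _ Y])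
    show "infinite (Field |UNIV :: nat set set| )" by (simp add: Field_card_of flip: Pow_UNIV)
  qed (auto intro: card_of_mono1 simp: card_of_card_order_on Field_card_of)
  then have "\<exists>f. inj_on f (\<K> \<times> Y) \<and> (\<forall>i\<in>\<K> \<times> Y. f i \<in> {B\<in>\<B>. infinite (B \<inter> fst i)})"
    by (intro injective_choice) (auto simp: \<K>_def intro: ordLeq_transitive)
  then obtain f where f: "inj_on f (\<K> \<times> Y)"
    "\<And>K \<xi>. K \<in> \<K> \<Longrightarrow> \<xi> \<in> Y \<Longrightarrow> f (K, \<xi>) \<in> \<B> \<and> infinite (f (K, \<xi>) \<inter> K)"
    by force
  define \<C> where "\<C> \<xi> = {f (K, \<xi>) | K. K \<in> \<K> \<and> \<xi> \<in> Y}" for \<xi>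
  show ?thesis
  proof (rule that[of \<C>])
    show "\<C> \<xi> \<subseteq> \<B>" for \<xi> using f(2) by (auto simp: \<C>_def)
    show "\<C> \<xi> \<inter> \<C> \<zeta> = {}" if "\<xi> \<noteq> \<zeta>" for \<xi> \<zeta>
      using f(1) that by (auto simp: \<C>_def dest: inj_onD)
    show "\<exists>B\<in>\<C> \<xi>. infinite (B \<inter> K)"
      if "|UNIV :: nat set set| \<le>o |{B\<in>\<B>. infinite (B \<inter> K)}|" "\<xi> \<in> Y" for K \<xi>
      using f(2)[of K \<xi>] that unfolding \<C>_def \<K>_def by blast
  qed
qed

text \<open>By induction on the size: a set with \<open>Suc n\<close> elements arises from a point
  and a set with \<open>n\<close> elements. The sizes then contribute only a countable
  union.\<close>

lemma card_of_finite_subsets: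
  assumes A: "infinite A"
  shows "|{X. X \<subseteq> A \<and> finite X}| \<le>o |A|"
proof -
  define S where "S n = {X. X \<subseteq> A \<and> finite X \<and> card X = n}" for n
  have "|S n| \<le>o |A|" for n
  proof (induction n)
    case 0
    have "S 0 = {{}}" by (auto simp: S_def)
    then show ?case using A by (metis card_of_singl_ordLeq finite.emptyI)
  next
    case (Suc n)
    have "S (Suc n) \<subseteq> (\<lambda>(a, X). insert a X) ` (A \<times> S n)"
    proof
      fix X assume X: "X \<in> S (Suc n)"
      then have "X \<noteq> {}" by (auto simp: S_def)
      then obtain a where a: "a \<in> X" by blast
      then have "X = insert a (X - {a})" by blast
      moreover have "(a, X - {a}) \<in> A \<times> S n" using X a by (auto simp: S_def)
      ultimately show "X \<in> (\<lambda>(a, X). insert a X) ` (A \<times> S n)"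
        by (metis (no_types, lifting) case_prod_conv image_eqI)
    qed
    then have "|S (Suc n)| \<le>o |A \<times> S n|"
      using card_of_mono1 card_of_image ordLeq_transitive by blast
    also have "|A \<times> S n| \<le>o |A|"
      using A Suc by (intro card_of_Times_ordLeq_infinite_Field)
        (auto intro: card_of_mono1 simp: Field_card_of card_of_card_order_on)
    finally show ?case .
  qed
  then have "|\<Union>n\<in>UNIV. S n| \<le>o |A|"
    using A by (intro card_of_UNION_ordLeq_infinite) (auto simp flip: infinite_iff_card_of_nat)
  moreover have "{X. X \<subseteq> A \<and> finite X} = (\<Union>n\<in>UNIV. S n)" by (auto simp: S_def)
  ultimately show ?thesis by simp
qed

text \<open>Otherwise \<open>Y\<close> would be a union of at most \<open>|B|\<close> finite fibres
  and so have cardinality at most \<open>|B|\<close>.\<close>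

lemma infinite_fibre:
  assumes "infinite B" "|W| \<le>o |B|" "|B| <o |Y|" "\<And>y. y \<in> Y \<Longrightarrow> h y \<in> W"
  shows "\<exists>w\<in>W. infinite {y\<in>Y. h y = w}"
proof (rule ccontr)
  assume "\<not> ?thesis"
  then have "|{y\<in>Y. h y = w}| \<le>o |B|" if "w \<in> W" for w
    using that assms(1) by (metis card_of_Well_order card_of_ordLeq_finite ordLeq_total)
  then have "|\<Union>w\<in>W. {y\<in>Y. h y = w}| \<le>o |B|"
    using assms(1,2) by (intro card_of_UNION_ordLeq_infinite) auto
  moreover have "Y = (\<Union>w\<in>W. {y\<in>Y. h y = w})" using assms(4) by blast
  ultimately show False using assms(3) not_ordLess_ordLeq by metis
qed

section \<open>Ideals generated by blocks of interval partitions\<close>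

text \<open>Cut points of the interval partition attached to \<open>f\<close>. The sum makes the
  next cut point exceed every value of \<open>f\<close> up to the current one; the successor makes
  the sequence strictly increasing.\<close>

definition cutpt :: "(nat \<Rightarrow> nat) \<Rightarrow> nat \<Rightarrow> nat" where
  "cutpt f l = ((\<lambda>n. (\<Sum>k\<le>n. f k) + Suc n) ^^ l) 0"

definition blocks :: "(nat \<Rightarrow> nat) \<Rightarrow> nat set \<Rightarrow> nat set" where
  "blocks f A = (\<Union>l\<in>A. {cutpt f l..<cutpt f (Suc l)})"

lemma cutpt_0 [simp]: "cutpt f 0 = 0"
  by (simp add: cutpt_def)

lemma cutpt_Suc: "cutpt f (Suc l) = (\<Sum>k\<le>cutpt f l. f k) + Suc (cutpt f l)"
  by (simp add: cutpt_def)

lemma strict_mono_cutpt: "strict_mono (cutpt f)"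
  unfolding strict_mono_Suc_iff by (simp add: cutpt_Suc)

lemma ex_cutpt_interval: "\<exists>l. cutpt f l \<le> n \<and> n < cutpt f (Suc l)"
proof -
  define l where "l = (LEAST l. n < cutpt f (Suc l))"
  have "Suc n \<le> cutpt f (Suc n)" by (rule strict_mono_imp_increasing[OF strict_mono_cutpt])
  then have "n < cutpt f (Suc n)" by simp
  then have "n < cutpt f (Suc l)" unfolding l_def by (rule LeastI)
  moreover have "cutpt f l \<le> n"
  proof (cases l)
    case (Suc k)
    then show ?thesis using not_less_Least[of k "\<lambda>l. n < cutpt f (Suc l)"] unfolding l_def by force
  qed simp
  ultimately show ?thesis by blast
qed

lemma cutpt_interval_unique:
  assumes "x \<in> {cutpt f l..<cutpt f (Suc l)}" "x \<in> {cutpt f k..<cutpt f (Suc k)}"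
  shows "l = k"
proof -
  have "cutpt f l < cutpt f (Suc k)" "cutpt f k < cutpt f (Suc l)" using assms by auto
  then show ?thesis by (simp add: strict_mono_less[OF strict_mono_cutpt])
qed

text \<open>Intervals with different indices are disjoint, so a common point lies in an interval
  whose index is in both sets.\<close>

lemma finite_blocks_Int:
  assumes "finite (A \<inter> A')"
  shows "finite (blocks f A \<inter> blocks f A')"
proof (rule finite_subset)
  show "blocks f A \<inter> blocks f A' \<subseteq> blocks f (A \<inter> A')"
    unfolding blocks_def using cutpt_interval_unique by blast
  show "finite (blocks f (A \<inter> A'))" using assms by (simp add: blocks_def)
qed

text \<open>
  If almost no block of \<open>f\<close> contains an interval of \<open>m\<close>, then two consecutive cut points of \<open>f\<close> are at
  most one step of \<open>n \<mapsto> m (n + 1)\<close> apart, so that two such steps bound \<open>f\<close>.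
\<close>
lemma unbounded_catches_intervals:
  assumes F: "\<not> has_upper_bound F" and m: "strict_mono m"
  shows "\<exists>f\<in>F. infinite {l. \<exists>k. cutpt f l \<le> m k \<and> m (Suc k) \<le> cutpt f (Suc l)}"
proof (rule ccontr)
  assume neg: "\<not> ?thesis"
  define M where "M n = m (Suc n)" for n
  have M_mono: "M a \<le> M b" if "a \<le> b" for a b
    using that m by (simp add: M_def strict_mono_less_eq)
  have "le_bd f (\<lambda>n. M (M n))" if f: "f \<in> F" for f
  proof -
    define G where "G = {l. \<exists>k. cutpt f l \<le> m k \<and> m (Suc k) \<le> cutpt f (Suc l)}"
    have "finite G" using neg f by (simp add: G_def)
    then obtain N where "\<forall>l\<in>G. l \<le> N" unfolding finite_nat_set_iff_bounded_le by blast
    then have N: "l \<notin> G" if "N < l" for l using that by force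
    \<comment> \<open>The interval of \<open>m\<close> with index \<open>cutpt f l\<close> starts no
      earlier than \<open>cutpt f l\<close>; since \<open>l\<close> is outside \<open>G\<close>, it
      must end after the next cut point.\<close>
    have step: "cutpt f (Suc l) < M (cutpt f l)" if "N < l" for l
    proof -
      have "cutpt f l \<le> m (cutpt f l)" by (rule strict_mono_imp_increasing[OF m])
      then show ?thesis using N[OF that] unfolding G_def M_def
        by (metis (mono_tags, lifting) mem_Collect_eq not_le)
    qed
    have "f n \<le> M (M n)" if n: "cutpt f (Suc N) < n" for n
    proof -
      obtain l where l: "cutpt f l \<le> n" "n < cutpt f (Suc l)" using ex_cutpt_interval by blast
      have "cutpt f (Suc N) < cutpt f (Suc l)" using n l by simp
      then have Nl: "N < l" by (simp add: strict_mono_less[OF strict_mono_cutpt])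
      \<comment> \<open>The value \<open>f n\<close> is one summand in the definition of the cut
        point two places after \<open>cutpt f l\<close>, which is reached in two steps of
        \<open>M\<close>.\<close>
      have "f n \<le> (\<Sum>k\<le>cutpt f (Suc l). f k)" using l(2) by (intro member_le_sum) auto
      also have "\<dots> \<le> cutpt f (Suc (Suc l))" using cutpt_Suc[of f "Suc l"] by simp
      also have "\<dots> \<le> M (cutpt f (Suc l))" using step[of "Suc l"] Nl by simp
      also have "\<dots> \<le> M (M (cutpt f l))" using step[OF Nl] by (intro M_mono) simp
      also have "\<dots> \<le> M (M n)" using l(1) by (intro M_mono)
      finally show ?thesis .
    qed
    then show ?thesis unfolding le_bd_def by blast
  qed
  then show False using F unfolding has_upper_bound_def by blast
qed

text \<open>Generators are recorded as triples, not as bare sets of blocks, since the pairs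
  \<open>(f, \<delta>)\<close> are later compared across different colours.\<close>

definition block_ideal ::
  "(nat \<Rightarrow> nat) set \<Rightarrow> 'd set \<Rightarrow> ('d \<Rightarrow> nat set set) \<Rightarrow> nat set set" where
  "block_ideal F \<DD> \<C> = {B. infinite B \<and>
     (\<exists>T. finite T \<and> T \<subseteq> F \<times> Sigma \<DD> \<C> \<and> B \<subseteq>\<^sup>* (\<Union>(f, \<delta>, A)\<in>T. blocks f A))}"

text \<open>Unboundedness provides an \<open>f\<close> with infinitely many blocks that contain an
  interval of \<open>m\<close>; \<open>hit\<close> provides an \<open>A\<close> containing
  infinitely many of their indices. The intervals inside those blocks are covered by the single
  generator \<open>blocks f A\<close>.\<close>

lemma groupwise_dense_block_ideal:
  assumes F: "\<not> has_upper_bound F"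
    and hit: "\<And>K. infinite K \<Longrightarrow> \<exists>\<delta>\<in>\<DD>. \<exists>A\<in>\<C> \<delta>. infinite (A \<inter> K)"
  shows "groupwise_dense_ideal (block_ideal F \<DD> \<C>)"
proof -
  let ?I = "block_ideal F \<DD> \<C>"
  define U where "U T = (\<Union>(f, \<delta>, A)\<in>T. blocks f A)" for T :: "((nat \<Rightarrow> nat) \<times> 'a \<times> nat set) set"
  define P where "P B T \<longleftrightarrow> finite T \<and> T \<subseteq> F \<times> Sigma \<DD> \<C> \<and> B \<subseteq>\<^sup>* U T" for B T
  have I: "B \<in> ?I \<longleftrightarrow> infinite B \<and> (\<exists>T. P B T)" for B
    unfolding block_ideal_def U_def P_def by blast
  have sub: "P B' T" if "P B T" "B' \<subseteq> B" for B B' T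
    using that almost_subset_trans[OF subset_imp_almost_subset] unfolding P_def by blast
  have un: "P (B \<union> B') (T \<union> T')" if BB: "P B T" "P B' T'" for B B' T T'
  proof -
    have "B \<union> B' - U (T \<union> T') \<subseteq> (B - U T) \<union> (B' - U T')" unfolding U_def by blast
    then show ?thesis using BB unfolding P_def almost_subset_def
      by (auto intro: finite_subset)
  qed
  \<comment> \<open>Finite sets are covered by no generators at all, so membership in the full ideal
    amounts to the existence of some \<open>T\<close>.\<close>
  have fin: "P B {}" if "finite B" for B
    using that unfolding P_def almost_subset_def by auto
  have "groupwise_dense ?I"
    unfolding groupwise_dense_def
  proof (intro conjI ballI allI impI)
    fix B B' assume "B' \<subseteq> B \<and> B \<in> ?I \<and> infinite B'" then show "B' \<in> ?I" unfolding I using sub by blast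
  next
    fix m :: "nat \<Rightarrow> nat" assume m: "strict_mono m"
    obtain f where f: "f \<in> F" "infinite {l. \<exists>k. cutpt f l \<le> m k \<and> m (Suc k) \<le> cutpt f (Suc l)}"
      using unbounded_catches_intervals[OF F m] by blast
    obtain \<delta> A where A: "\<delta> \<in> \<DD>" "A \<in> \<C> \<delta>"
      "infinite (A \<inter> {l. \<exists>k. cutpt f l \<le> m k \<and> m (Suc k) \<le> cutpt f (Suc l)})"
      using hit[OF f(2)] by blast
    define L where "L = A \<inter> {l. \<exists>k. cutpt f l \<le> m k \<and> m (Suc k) \<le> cutpt f (Suc l)}"
    have "\<forall>l\<in>L. \<exists>k. cutpt f l \<le> m k \<and> m (Suc k) \<le> cutpt f (Suc l)" unfolding L_def by blast
    then obtain k where k: "\<And>l. l \<in> L \<Longrightarrow> cutpt f l \<le> m (k l) \<and> m (Suc (k l)) \<le> cutpt f (Suc l)"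
      by metis
    \<comment> \<open>The point \<open>m (k l)\<close> lies in the block with index \<open>l\<close>
      and determines it; hence infinitely many intervals are selected.\<close>
    have "inj_on k L"
    proof (rule inj_onI)
      fix l l' assume l: "l \<in> L" "l' \<in> L" "k l = k l'"
      have "m (k l) < m (Suc (k l))" using m by (simp add: strict_mono_def)
      then show "l = l'" using k[OF l(1)] k[OF l(2)] l(3)
        by (intro cutpt_interval_unique[of "m (k l)" f]) auto
    qed
    then have inf: "infinite (k ` L)" using A(3) unfolding L_def[symmetric] by (simp add: finite_image_iff)
    have "(\<Union>i\<in>k ` L. {m i..<m (Suc i)}) \<subseteq> blocks f A"
    proof
      fix x assume "x \<in> (\<Union>i\<in>k ` L. {m i..<m (Suc i)})"
      then obtain l where l: "l \<in> L" "m (k l) \<le> x" "x < m (Suc (k l))" by auto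
      then show "x \<in> blocks f A"
        using k[OF l(1)] unfolding blocks_def L_def by (intro UN_I[of l]) auto
    qed
    then have "P (\<Union>i\<in>k ` L. {m i..<m (Suc i)}) {(f, \<delta>, A)}"
      using f(1) A(1,2) unfolding P_def U_def by (auto intro!: subset_imp_almost_subset)
    moreover have "infinite (\<Union>i\<in>k ` L. {m i..<m (Suc i)})"
    proof
      assume "finite (\<Union>i\<in>k ` L. {m i..<m (Suc i)})"
      moreover have "m ` k ` L \<subseteq> (\<Union>i\<in>k ` L. {m i..<m (Suc i)})"
        using m by (auto simp: strict_mono_def)
      ultimately have "finite (m ` k ` L)" by (rule rev_finite_subset)
      then show False using inf m
        by (meson finite_imageD inj_on_subset strict_mono_imp_inj_on subset_UNIV)
    qed
    ultimately show "\<exists>V. infinite V \<and> (\<Union>i\<in>V. {m i..<m (Suc i)}) \<in> ?I"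
      using inf I by blast
  qed (auto simp: I)
  moreover have J: "B \<in> ?I \<union> {A. finite A} \<longleftrightarrow> (\<exists>T. P B T)" for B using I fin by blast
  have "ideal_of_subsets (?I \<union> {A. finite A})"
    unfolding ideal_of_subsets_def
  proof (intro conjI allI ballI impI)
    fix B B' assume "B \<in> ?I \<union> {A. finite A}" "B' \<in> ?I \<union> {A. finite A}"
    then show "B \<union> B' \<in> ?I \<union> {A. finite A}" unfolding J using un by blast
  next
    fix B B' assume "B' \<subseteq> B \<and> B \<in> ?I \<union> {A. finite A}"
    then show "B' \<in> ?I \<union> {A. finite A}" unfolding J using sub by blast
  qed simp
  ultimately show ?thesis unfolding groupwise_dense_ideal_def by blast
qed

text \<open>Take one colour more than there are keys \<open>(f, \<delta>)\<close> in
  \<open>w\<close>. A point covered for each of these colours is covered twice with the same key,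
  hence lies in the finite overlap of blocks of one \<open>f\<close> along two almost disjoint
  sets.\<close>

lemma blocks_pigeonhole:
  fixes \<C> :: "'c \<Rightarrow> 'd \<Rightarrow> nat set set" and T :: "'c \<Rightarrow> ((nat \<Rightarrow> nat) \<times> 'd \<times> nat set) set"
  assumes X: "infinite X" and w: "finite w"
    and T: "\<And>\<xi>. \<xi> \<in> X \<Longrightarrow> finite (T \<xi>)" "\<And>\<xi>. \<xi> \<in> X \<Longrightarrow> T \<xi> \<subseteq> F \<times> Sigma \<DD> (\<C> \<xi>)"
      "\<And>\<xi>. \<xi> \<in> X \<Longrightarrow> (\<lambda>(f, \<delta>, A). (f, \<delta>)) ` T \<xi> \<subseteq> w"
      "\<And>\<xi>. \<xi> \<in> X \<Longrightarrow> B \<subseteq>\<^sup>* (\<Union>(f, \<delta>, A)\<in>T \<xi>. blocks f A)"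
    and ad: "\<And>\<xi> \<zeta> \<delta> A A'. \<xi> \<noteq> \<zeta> \<Longrightarrow> \<delta> \<in> \<DD> \<Longrightarrow> A \<in> \<C> \<xi> \<delta> \<Longrightarrow> A' \<in> \<C> \<zeta> \<delta> \<Longrightarrow> finite (A \<inter> A')"
  shows "finite B"
proof -
  define bl where "bl t = blocks (fst t) (snd (snd t))" for t :: "(nat \<Rightarrow> nat) \<times> 'd \<times> nat set"
  define key where "key t = (fst t, fst (snd t))" for t :: "(nat \<Rightarrow> nat) \<times> 'd \<times> nat set"
  obtain Y where Y: "Y \<subseteq> X" "finite Y" "card Y = Suc (card w)"
    using infinite_arbitrarily_large[OF X] by metis
  \<comment> \<open>The exceptional points: \<open>N\<close> holds those missed by the cover of some
    colour in \<open>Y\<close>, and \<open>O'\<close> the overlaps of blocks with equal keys and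
    different colours.\<close>
  define N where "N = (\<Union>\<xi>\<in>Y. B - (\<Union>t\<in>T \<xi>. bl t))"
  define O' where "O' = (\<Union>\<xi>\<in>Y. \<Union>\<zeta>\<in>Y - {\<xi>}. \<Union>t\<in>T \<xi>. \<Union>t'\<in>{t'\<in>T \<zeta>. key t = key t'}. bl t \<inter> bl t')"
  have "finite (B - (\<Union>t\<in>T \<xi>. bl t))" if "\<xi> \<in> Y" for \<xi>
    using T(4) Y(1) that unfolding bl_def almost_subset_def by (auto simp: case_prod_beta)
  then have "finite N" unfolding N_def using Y(2) by blast
  moreover have "finite (bl t \<inter> bl t')"
    if "\<xi> \<in> Y" "\<zeta> \<in> Y" "\<xi> \<noteq> \<zeta>" "t \<in> T \<xi>" "t' \<in> T \<zeta>" "key t = key t'" for \<xi> \<zeta> t t'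
  proof -
    have "t \<in> F \<times> Sigma \<DD> (\<C> \<xi>)" "t' \<in> F \<times> Sigma \<DD> (\<C> \<zeta>)" using that T(2) Y(1) by blast+
    then obtain f \<delta> A A' where tt: "t = (f, \<delta>, A)" "t' = (f, \<delta>, A')" "\<delta> \<in> \<DD>" "A \<in> \<C> \<xi> \<delta>" "A' \<in> \<C> \<zeta> \<delta>"
      using \<open>key t = key t'\<close> unfolding key_def by auto
    then show ?thesis using ad[OF \<open>\<xi> \<noteq> \<zeta>\<close> tt(3-5)] by (simp add: bl_def finite_blocks_Int)
  qed
  then have "finite O'"
    unfolding O'_def using Y(1,2) T(1) by (intro finite_UN_I) auto
  moreover have "b \<in> N \<union> O'" if b: "b \<in> B" for b
  proof (rule ccontr)
    assume nb: "b \<notin> N \<union> O'"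
    then have "\<exists>t\<in>T \<xi>. b \<in> bl t" if "\<xi> \<in> Y" for \<xi> using that b unfolding N_def by blast
    then obtain t where t: "\<And>\<xi>. \<xi> \<in> Y \<Longrightarrow> t \<xi> \<in> T \<xi> \<and> b \<in> bl (t \<xi>)" by metis
    have "key (t \<xi>) \<in> w" if "\<xi> \<in> Y" for \<xi>
    proof -
      have "key ` T \<xi> \<subseteq> w" using T(3) that Y(1) unfolding key_def by (auto simp: case_prod_beta)
      then show ?thesis using t[OF that] by blast
    qed
    then have "card ((\<lambda>\<xi>. key (t \<xi>)) ` Y) \<le> card w" using w by (intro card_mono) auto
    then have "\<not> inj_on (\<lambda>\<xi>. key (t \<xi>)) Y" using Y(3) by (intro pigeonhole) simp
    then obtain \<xi> \<zeta> where xz: "\<xi> \<in> Y" "\<zeta> \<in> Y" "\<xi> \<noteq> \<zeta>" "key (t \<xi>) = key (t \<zeta>)"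
      unfolding inj_on_def by blast
    then have "b \<in> O'" unfolding O'_def using t[OF xz(1)] t[OF xz(2)] by blast
    then show False using nb by blast
  qed
  ultimately show ?thesis by (meson finite_UnI finite_subset subsetI)
qed

lemma infinite_unbounded:
  assumes "\<not> has_upper_bound F"
  shows "infinite F"
proof
  assume fin: "finite F"
  have "f n \<le> (\<Sum>g\<in>F. g n)" if "f \<in> F" for f n
    using fin that by (intro member_le_sum) auto
  then have "\<forall>f\<in>F. le_bd f (\<lambda>n. \<Sum>g\<in>F. g n)" unfolding le_bd_def by blast
  then show False using assms unfolding has_upper_bound_def by blast
qed

text \<open>One ideal for each infinite \<open>B\<close>, avoiding that \<open>B\<close>, already
  forms a sequence of the required kind.\<close>

lemma gf_le_continuum: "gf \<le>o |UNIV :: nat set set|"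
proof -
  obtain \<I> where \<I>: "\<And>B. infinite B \<Longrightarrow> groupwise_dense_ideal (\<I> B) \<and> (\<forall>A\<in>\<I> B. \<not> B \<subseteq>\<^sup>* A)"
    using ex_groupwise_dense_ideal_avoiding by metis
  then have "gf_sequence |{B :: nat set. infinite B}| \<I>"
    unfolding gf_sequence_def by (auto simp: Field_card_of)
  then have "gf \<le>o |{B :: nat set. infinite B}|" using card_of_Card_order by (intro gf_is_min(3))
  then show ?thesis using card_of_mono1[OF subset_UNIV] ordLeq_transitive by blast
qed

theorem theorem2p5:
  shows "gf \<le>o cardSuc unbounded_number"
proof (cases "|UNIV :: nat set set| \<le>o cardSuc unbounded_number")
  case True
  then show ?thesis using gf_le_continuum ordLeq_transitive by blast
next
  case False
  obtain F where F: "\<not> has_upper_bound F" and b: "unbounded_number = |F|"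
    using unbounded_number_is_min(1) by blast
  let ?\<kappa> = "cardSuc unbounded_number"
  have card_\<kappa>: "Card_order ?\<kappa>" unfolding b by (intro cardSuc_Card_order card_of_Card_order)
  have \<kappa>_Field: "|Field ?\<kappa>| =o ?\<kappa>" using card_\<kappa> by (rule card_of_Field_ordIso)
  \<comment> \<open>Here the continuum leaves room for \<open>?\<kappa>\<close> colours.\<close>
  have "?\<kappa> \<le>o |UNIV :: nat set set|"
    using False card_\<kappa> by (metis card_of_Well_order card_order_on_well_order_on ordLeq_total)
  then have \<kappa>_le: "|Field ?\<kappa>| \<le>o |UNIV :: nat set set|" using \<kappa>_Field ordIso_ordLeq_trans by blast
  have F_less: "|F| <o |Field ?\<kappa>|"
    using cardSuc_greater[OF card_of_Card_order, of F] \<kappa>_Field unfolding b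
    by (metis ordIso_symmetric ordLess_ordIso_trans)
  obtain \<DD> :: "nat set set set" where \<DD>: "\<And>D. D \<in> \<DD> \<Longrightarrow> dense_open D" "\<not> (\<exists>A. \<forall>D\<in>\<DD>. A \<in> D)"
    "|\<DD>| \<le>o |F|" "infinite \<DD>"
    "\<And>\<EE>. (\<And>D. D \<in> \<EE> \<Longrightarrow> dense_open D) \<Longrightarrow> |\<EE>| <o |\<DD>| \<Longrightarrow>
       dense_open {A. infinite A \<and> (\<forall>D\<in>\<EE>. A \<in> D)}"
    by (rule minimal_family[OF F]) blast
  obtain \<B> :: "nat set set \<Rightarrow> nat set set" where \<B>:
    "\<And>\<delta>. \<delta> \<in> \<DD> \<Longrightarrow> almost_disjoint (\<B> \<delta>)"
    "\<And>K. infinite K \<Longrightarrow> \<exists>\<delta>\<in>\<DD>. |UNIV :: nat set set| \<le>o |{B\<in>\<B> \<delta>. infinite (B \<inter> K)}|"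
    by (rule base_tree[OF \<DD>(1,2,4,5)]) blast+
  define coloured where "coloured \<delta> \<C> \<longleftrightarrow> (\<forall>\<xi>. \<C> \<xi> \<subseteq> \<B> \<delta>) \<and> (\<forall>\<xi> \<zeta>. \<xi> \<noteq> \<zeta> \<longrightarrow> \<C> \<xi> \<inter> \<C> \<zeta> = {}) \<and>
      (\<forall>K \<xi>. |UNIV :: nat set set| \<le>o |{B\<in>\<B> \<delta>. infinite (B \<inter> K)}| \<longrightarrow> \<xi> \<in> Field ?\<kappa> \<longrightarrow>
         (\<exists>B\<in>\<C> \<xi>. infinite (B \<inter> K)))" for \<delta> \<C>
  have "\<exists>\<C>. coloured \<delta> \<C>" for \<delta>
    unfolding coloured_def by (rule colouring[OF \<kappa>_le, of "\<B> \<delta>"]) blast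
  then obtain \<C> where col: "\<And>\<delta>. coloured \<delta> (\<C> \<delta>)" by metis
  have \<C>: "\<C> \<delta> \<xi> \<subseteq> \<B> \<delta>" "\<xi> \<noteq> \<zeta> \<Longrightarrow> \<C> \<delta> \<xi> \<inter> \<C> \<delta> \<zeta> = {}"
    "|UNIV :: nat set set| \<le>o |{B\<in>\<B> \<delta>. infinite (B \<inter> K)}| \<Longrightarrow> \<xi> \<in> Field ?\<kappa> \<Longrightarrow>
       \<exists>B\<in>\<C> \<delta> \<xi>. infinite (B \<inter> K)" for \<delta> \<xi> \<zeta> K
    using col[of \<delta>] by (simp_all add: coloured_def)
  define \<I> where "\<I> \<xi> = block_ideal F \<DD> (\<lambda>\<delta>. \<C> \<delta> \<xi>)" for \<xi>
  have "groupwise_dense_ideal (\<I> \<xi>)" if "\<xi> \<in> Field ?\<kappa>" for \<xi>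
    unfolding \<I>_def using \<B>(2) \<C>(3) that by (intro groupwise_dense_block_ideal[OF F]) blast
  moreover have "\<exists>\<xi>\<in>Field ?\<kappa>. \<forall>A\<in>\<I> \<xi>. \<not> B \<subseteq>\<^sup>* A" if B: "infinite B" for B
  proof (rule ccontr)
    assume "\<not> ?thesis"
    then have neg: "\<exists>A\<in>\<I> \<xi>. B \<subseteq>\<^sup>* A" if "\<xi> \<in> Field ?\<kappa>" for \<xi> using that by blast
    define covers where "covers \<xi> T \<longleftrightarrow> finite T \<and> T \<subseteq> F \<times> Sigma \<DD> (\<lambda>\<delta>. \<C> \<delta> \<xi>) \<and>
      B \<subseteq>\<^sup>* (\<Union>(f, \<delta>, A)\<in>T. blocks f A)" for \<xi> T
    have "\<exists>T. covers \<xi> T" if "\<xi> \<in> Field ?\<kappa>" for \<xi>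
    proof -
      obtain A where A: "A \<in> \<I> \<xi>" "B \<subseteq>\<^sup>* A" using neg \<open>\<xi> \<in> Field ?\<kappa>\<close> by blast
      then show ?thesis
        using almost_subset_trans[OF A(2)] unfolding \<I>_def block_ideal_def covers_def by blast
    qed
    then obtain T where cov: "\<And>\<xi>. \<xi> \<in> Field ?\<kappa> \<Longrightarrow> covers \<xi> (T \<xi>)" by metis
    have T: "finite (T \<xi>)" "T \<xi> \<subseteq> F \<times> Sigma \<DD> (\<lambda>\<delta>. \<C> \<delta> \<xi>)"
      "B \<subseteq>\<^sup>* (\<Union>(f, \<delta>, A)\<in>T \<xi>. blocks f A)" if "\<xi> \<in> Field ?\<kappa>" for \<xi>
      using cov[OF that] by (simp_all add: covers_def)
    \<comment> \<open>Only the keys of the cover are kept; the sets \<open>A\<close> depend on the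
      colour.\<close>
    define h where "h \<xi> = (\<lambda>(f, \<delta>, A). (f, \<delta>)) ` T \<xi>" for \<xi>
    have inf: "infinite F" by (rule infinite_unbounded[OF F])
    have FD: "|F \<times> \<DD>| \<le>o |F|" "infinite (F \<times> \<DD>)"
      using inf \<DD>(3,4) by (auto intro!: card_of_Times_ordLeq_infinite_Field card_of_mono1
          simp: Field_card_of card_of_card_order_on finite_cartesian_product_iff)
    \<comment> \<open>There are at most \<open>|F|\<close> finite sets of keys but
      \<open>?\<kappa>\<close> many colours, so a single finite set of keys serves infinitely many
      colours.\<close>
    have "\<exists>w\<in>{w. w \<subseteq> F \<times> \<DD> \<and> finite w}. infinite {\<xi>\<in>Field ?\<kappa>. h \<xi> = w}"
    proof (rule infinite_fibre[OF inf _ F_less])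
      show "|{w. w \<subseteq> F \<times> \<DD> \<and> finite w}| \<le>o |F|"
        using card_of_finite_subsets[OF FD(2)] FD(1) by (rule ordLeq_transitive)
      show "h \<xi> \<in> {w. w \<subseteq> F \<times> \<DD> \<and> finite w}" if "\<xi> \<in> Field ?\<kappa>" for \<xi>
        using T(1,2)[OF that] unfolding h_def by auto
    qed
    then obtain w where w: "finite w" "infinite {\<xi>\<in>Field ?\<kappa>. h \<xi> = w}" by blast
    have "finite B"
    proof (rule blocks_pigeonhole[OF w(2,1), where T = T and F = F and \<DD> = \<DD> and \<C> = "\<lambda>\<xi> \<delta>. \<C> \<delta> \<xi>"])
      show "finite (A \<inter> A')" if "\<xi> \<noteq> \<zeta>" "\<delta> \<in> \<DD>" "A \<in> \<C> \<delta> \<xi>" "A' \<in> \<C> \<delta> \<zeta>" for \<xi> \<zeta> \<delta> A A'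
      proof -
        have "A \<noteq> A'" using \<C>(2)[OF that(1), of \<delta>] that(3,4) by blast
        moreover have "A \<in> \<B> \<delta>" "A' \<in> \<B> \<delta>" using that(3,4) \<C>(1)[of \<delta>] by (auto dest: subsetD)
        ultimately show ?thesis using \<B>(1)[OF that(2)] by (simp add: almost_disjoint_def)
      qed
    next
      fix \<xi> assume \<xi>: "\<xi> \<in> {\<xi>\<in>Field ?\<kappa>. h \<xi> = w}"
      then have \<xi>': "\<xi> \<in> Field ?\<kappa>" by simp
      show "finite (T \<xi>)" "T \<xi> \<subseteq> F \<times> Sigma \<DD> (\<lambda>\<delta>. \<C> \<delta> \<xi>)"
        "B \<subseteq>\<^sup>* (\<Union>(f, \<delta>, A)\<in>T \<xi>. blocks f A)" by (fact T[OF \<xi>'])+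
      show "(\<lambda>(f, \<delta>, A). (f, \<delta>)) ` T \<xi> \<subseteq> w" using \<xi> by (simp add: h_def)
    qed
    then show False using B by blast
  qed
  ultimately have "gf_sequence ?\<kappa> \<I>" unfolding gf_sequence_def by blast
  then show ?thesis by (rule gf_is_min(3)[OF card_\<kappa>])
qed

end
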